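(* Let $X$ and $U$ be real Hilbert spaces, let $M: X\supset D(M)\to X$ be a (possibly unbounded, nonlinear) maximally monotone operator, and let $B\in L(U,X)$ be a bounded linear operator with adjoint $B^*\in L(X,U)$. Let $F\subset U$ be closed and convex, and let $(x^\star,u^\star)\in D(M)\times\operatorname{int}F$ be a controlled steady state, i.e. $-M(x^\star)+Bu^\star=0$. Let $P_F:U\to U$ be the orthogonal projection onto $F$ and define the closed-loop operator $$M_{\mathrm{cl}}:X\supset D(M)\to X,\qquad M_{\mathrm{cl}}(x)=M(x)-B\,P_F\big(u^\star-B^*(x-x^\star)\big).$$ Let $(S_{\mathrm{cl}}(t))_{t\ge 0}$ be the semigroup on $\overline{D(M)}$ generated by $-M_{\mathrm{cl}}$. Assume that the closed-loop system $(M_{\mathrm{cl}},B)$, i.e. $\dot x=-M_{\mathrm{cl}}(x)$, $y=B^*x$, fulfills the VOVS property at $x^\star$. Then, for all $x_0\in\overline{D(M)}$, $$S_{\mathrm{cl}}(t)x_0\to x^\star\quad\text{in } X\qquad\text{as } t\to\infty.$$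
   Context: An operator $W:X\supset D(W)\to X$ is monotone if $\langle W(x)-W(z),x-z\rangle_X\ge 0$ for all $x,z\in D(W)$; it is maximal monotone (maximally monotone) if it admits no proper monotone extension, equivalently if it is monotone and $\lambda I+W$ is onto $X$ for some (hence all) $\lambda>0$. For a maximally monotone $W$, the semigroup generated by $-W$ is the family of nonexpansive mappings $S(t):\overline{D(W)}\to\overline{D(W)}$, $t\ge0$, given by $S(t)x_0=\lim_{n\to\infty}(I+\tfrac tn W)^{-n}x_0$; the function $t\mapsto S(t)x_0$ is the unique mild solution (strong solution if $x_0\in D(W)$) of $\dot x=-W(x)$, $x(0)=x_0$. The operator $M_{\mathrm{cl}}$ is maximally monotone, so $S_{\mathrm{cl}}$ is well defined. Vanishing output vanishing state (VOVS) property: for a maximally monotone operator $W$ with generated semigroup $(S(t))_{t\ge0}$ (generated by $-W$) and $B\in L(U,X)$, the system $(W,B)$ fulfills the VOVS property at $x^\star$ if for all $x_0\in\overline{D(W)}$: $\lim_{t\to\infty}B^*(S(t)x_0-x^\star)=0$ implies $\lim_{t\to\infty}S(t)x_0=x^\star$. *)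

theory Defs
  imports "HOL-Analysis.Analysis"
begin

text \<open>A real Hilbert space is a type of sort \<open>{real_inner, complete_space}\<close>. An unbounded
  operator \<open>W : X \<supset> D(W) \<rightarrow> X\<close> is a pair of a domain \<open>D\<close> and a total function \<open>W\<close>,
  whose values outside \<open>D\<close> are irrelevant.\<close>

definition op_graph :: "'x set \<Rightarrow> ('x \<Rightarrow> 'x) \<Rightarrow> ('x \<times> 'x) set" where
  "op_graph D W = {(x, W x) | x. x \<in> D}"

definition monotone_graph :: "('x::real_inner \<times> 'x) set \<Rightarrow> bool" where
  "monotone_graph G \<longleftrightarrow> (\<forall>(x, v) \<in> G. \<forall>(z, w) \<in> G. (v - w) \<bullet> (x - z) \<ge> 0)"

text \<open>The competing extensions range over arbitrary (possibly set-valued) monotone graphs.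
  Maximality among single-valued operators only would be strictly weaker, and would not be
  equivalent to surjectivity of \<open>\<lambda> I + W\<close>.\<close>

definition maximal_monotone :: "'x::real_inner set \<Rightarrow> ('x \<Rightarrow> 'x) \<Rightarrow> bool" where
  "maximal_monotone D W \<longleftrightarrow>
     monotone_graph (op_graph D W) \<and>
     (\<forall>G. monotone_graph G \<and> op_graph D W \<subseteq> G \<longrightarrow> G = op_graph D W)"

definition resolvent :: "'x::real_vector set \<Rightarrow> ('x \<Rightarrow> 'x) \<Rightarrow> real \<Rightarrow> 'x \<Rightarrow> 'x" where
  "resolvent D W h = the_inv_into D (\<lambda>x. x + h *\<^sub>R W x)"

text \<open>\<open>generated_semigroup D W\<close> is generated by \<open>-W\<close>; it is meaningful for \<open>t \<ge> 0\<close> and points of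
  \<open>closure D\<close>. The case \<open>t = 0\<close> is separate because \<open>resolvent D W 0\<close> is the identity on
  \<open>D\<close> only, not on \<open>closure D\<close>.\<close>

definition generated_semigroup ::
  "'x::real_normed_vector set \<Rightarrow> ('x \<Rightarrow> 'x) \<Rightarrow> real \<Rightarrow> 'x \<Rightarrow> 'x" where
  "generated_semigroup D W t x0 =
     (if t = 0 then x0 else lim (\<lambda>n. (resolvent D W (t / real n) ^^ n) x0))"

definition VOVS ::
  "'x::real_inner set \<Rightarrow> ('x \<Rightarrow> 'x) \<Rightarrow> ('u::real_inner \<Rightarrow> 'x) \<Rightarrow> 'x \<Rightarrow> bool" where
  "VOVS D W B xs \<longleftrightarrow>
     (\<forall>x0 \<in> closure D.
        ((\<lambda>t. adjoint B (generated_semigroup D W t x0 - xs)) \<longlongrightarrow> 0) at_top \<longrightarrow>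
        ((\<lambda>t. generated_semigroup D W t x0) \<longlongrightarrow> xs) at_top)"

text \<open>The library's \<^const>\<open>closest_point\<close> is restricted to \<^class>\<open>heine_borel\<close> spaces, i.e. to
  finite dimension; this is the same definition without that restriction.\<close>

definition proj_onto :: "'u::real_inner set \<Rightarrow> 'u \<Rightarrow> 'u" where
  "proj_onto F u = (SOME p. p \<in> F \<and> (\<forall>q \<in> F. dist u p \<le> dist u q))"

definition closed_loop ::
  "('x::real_inner \<Rightarrow> 'x) \<Rightarrow> ('u::real_inner \<Rightarrow> 'x) \<Rightarrow> 'u set \<Rightarrow> 'x \<Rightarrow> 'u \<Rightarrow> 'x \<Rightarrow> 'x" where
  "closed_loop M B F xs us x = M x - B (proj_onto F (us - adjoint B (x - xs)))"

end

theory Submission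
  imports Defs
begin

text \<open>
  Let \<open>S\<close> be the closed-loop semigroup and write \<open>a x = us - adjoint B (x - xs)\<close> for the feedback
  before saturation, \<open>P\<close> for the projection onto \<open>F\<close>, and \<open>g x = P (a x) - us\<close>. Since \<open>P\<close> is
  firmly nonexpansive and the closed-loop operator \<open>W\<close> vanishes at \<open>xs\<close>, the operator \<open>W\<close> is
  monotone and satisfies \<open>|g x|\<^sup>2 \<le> W x \<bullet> (x - xs)\<close>. Formally, \<open>|x - xs|\<^sup>2 / 2\<close> therefore decays at
  least at the rate \<open>|g|\<^sup>2\<close> along trajectories, so that \<open>|g|\<^sup>2\<close> is integrable in time. A trajectory
  starting in \<open>D\<close> is Lipschitz in time, hence \<open>g\<close> tends to zero along it
  (\<open>dissipated_output_vanishes\<close>). As \<open>us\<close> is interior to \<open>F\<close>, the saturation is eventually inactive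
  (\<open>proj_onto_interior\<close>), so that \<open>- g\<close> is eventually the output error
  \<open>adjoint B (S t x - xs)\<close>, and the VOVS property gives convergence of the state. Nonexpansiveness
  of \<open>S t\<close> extends this from \<open>D\<close> to its closure.

  The semigroup is only given by the exponential formula, so its existence and regularity have to be
  derived from maximality. The surjectivity of \<open>I + h M\<close> is proved through the Fitzpatrick function
  (\<open>maximal_monotone_graph_meets_antidiagonal\<close>). For small \<open>h\<close> it extends to \<open>I + h W\<close>, because \<open>W\<close> is
  a Lipschitz perturbation of \<open>M\<close> (\<open>lipschitz_perturbation_range\<close>). Convergence of the formula
  and Lipschitz continuity in time both follow from one comparison of implicit Euler schemes
  with different step sizes (\<open>kobayashi_estimate\<close>). The energy inequality is proved for the Euler
  scheme and passed to the limit on time grids (\<open>dissipation_interval\<close>), because trajectories are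
  only known as limits of Euler orbits.
\<close>

section \<open>Strongly convex minimization, projections and adjoints in Hilbert spaces\<close>

text \<open>For a convex function \<open>f\<close> with epigraph \<open>S\<close> this minimizes \<open>f(z) + |z|\<^sup>2 / 2\<close>; the second
  conclusion says that \<open>- z0\<close> is a subgradient of \<open>f\<close> at \<open>z0\<close>. Working with the epigraph
  avoids functions with the value \<open>\<infinity>\<close>. Strong convexity of the quadratic term makes every
  minimizing sequence Cauchy, which yields a minimizer in infinite dimension, too. The choices of \<open>f\<close> below give
  the metric projection (\<open>f\<close> linear on \<open>F\<close>), the Riesz theorem (\<open>f\<close> linear) and the
  surjectivity theorem of Minty (\<open>f\<close> the Fitzpatrick function).\<close>

lemma quadratic_minimizer:
  fixes S :: "('a::{real_inner,complete_space} \<times> real) set"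
  assumes "closed S" "convex S" "S \<noteq> {}"
    and lb: "\<And>z r. (z, r) \<in> S \<Longrightarrow> c \<le> r + (z \<bullet> z) / 2"
  obtains z0 r0 where "(z0, r0) \<in> S" "\<And>z r. (z, r) \<in> S \<Longrightarrow> r0 \<le> r + z0 \<bullet> (z - z0)"
proof -
  define \<phi> where "\<phi> p = snd p + (fst p \<bullet> fst p) / 2" for p :: "'a \<times> real"
  define m where "m = Inf (\<phi> ` S)"
  have bdd: "bdd_below (\<phi> ` S)"
    by (rule bdd_belowI2[where m = c]) (use lb in \<open>auto simp: \<phi>_def\<close>)
  have m_le: "m \<le> \<phi> p" if "p \<in> S" for p
    unfolding m_def using bdd that by (simp add: cInf_lower)
  define \<delta> where "\<delta> n = inverse (real (Suc n))" for n
  have \<delta>: "\<delta> \<longlonglongrightarrow> 0" "0 < \<delta> n" "n \<le> k \<Longrightarrow> \<delta> k \<le> \<delta> n" for n k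
    using LIMSEQ_inverse_real_of_nat unfolding \<delta>_def by (auto intro!: le_imp_inverse_le)
  have "\<exists>p\<in>S. \<phi> p < m + \<delta> n" for n
  proof -
    have "m < m + \<delta> n" using \<delta>(2) by simp
    then show ?thesis
      unfolding m_def using bdd \<open>S \<noteq> {}\<close> by (subst (asm) cInf_less_iff) auto
  qed
  then obtain p where p: "\<And>n. p n \<in> S" "\<And>n. \<phi> (p n) < m + \<delta> n"
    by metis
  \<comment> \<open>The midpoint of two almost minimal points costs at least \<open>m\<close>; the parallelogram identity
    turns this into a bound on their distance.\<close>
  have gap: "(norm (fst (p n) - fst (p k)))\<^sup>2 \<le> 4 * (\<delta> n + \<delta> k)" for n k
  proof -
    let ?q = "(1/2) *\<^sub>R p n + (1/2) *\<^sub>R p k"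
    have "?q \<in> S"
      using \<open>convex S\<close> p(1) by (auto intro: convexD)
    then have "m \<le> \<phi> ?q" by (rule m_le)
    also have "\<phi> ?q = (\<phi> (p n) + \<phi> (p k)) / 2 - (norm (fst (p n) - fst (p k)))\<^sup>2 / 8"
      by (simp add: \<phi>_def power2_norm_eq_inner inner_diff_left inner_diff_right inner_add_left
          inner_add_right inner_commute field_simps)
    finally show ?thesis using p(2)[of n] p(2)[of k] by (simp add: field_simps)
  qed
  have "Cauchy (\<lambda>n. fst (p n))"
  proof (rule metric_CauchyI)
    fix e :: real
    assume "0 < e"
    then have "0 < e\<^sup>2 / 8" by simp
    then have "eventually (\<lambda>n. \<delta> n < e\<^sup>2 / 8) sequentially"
      by (rule order_tendstoD(2)[OF \<delta>(1)])
    then obtain N where N: "\<delta> N < e\<^sup>2 / 8"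
      by (auto simp: eventually_sequentially)
    have "dist (fst (p n)) (fst (p k)) < e" if "n \<ge> N" "k \<ge> N" for n k
    proof -
      have "(norm (fst (p n) - fst (p k)))\<^sup>2 < e\<^sup>2"
        using gap[of n k] N \<delta>(3)[OF that(1)] \<delta>(3)[OF that(2)] by (simp add: field_simps)
      then show ?thesis
        using \<open>0 < e\<close> by (simp add: dist_norm power_less_imp_less_base)
    qed
    then show "\<exists>N. \<forall>n\<ge>N. \<forall>k\<ge>N. dist (fst (p n)) (fst (p k)) < e" by blast
  qed
  then obtain z0 where z0: "(\<lambda>n. fst (p n)) \<longlonglongrightarrow> z0"
    using Cauchy_convergent convergent_def by blast
  have "(\<lambda>n. m + \<delta> n) \<longlonglongrightarrow> m"
    using tendsto_add[OF tendsto_const \<delta>(1), of m] by simp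
  then have \<phi>_lim: "(\<lambda>n. \<phi> (p n)) \<longlonglongrightarrow> m"
    by (rule tendsto_sandwich[OF _ _ tendsto_const, rotated 2])
      (use m_le p in \<open>auto simp: less_imp_le\<close>)
  define r0 where "r0 = m - (z0 \<bullet> z0) / 2"
  have "(\<lambda>n. \<phi> (p n) - (fst (p n) \<bullet> fst (p n)) / 2) \<longlonglongrightarrow> r0"
    unfolding r0_def by (intro tendsto_intros \<phi>_lim z0) simp
  then have "(\<lambda>n. snd (p n)) \<longlonglongrightarrow> r0"
    by (simp add: \<phi>_def)
  then have "(\<lambda>n. (fst (p n), snd (p n))) \<longlonglongrightarrow> (z0, r0)"
    by (intro tendsto_Pair z0)
  then have mem: "(z0, r0) \<in> S"
    using closed_sequentially[OF \<open>closed S\<close>, of "\<lambda>n. (fst (p n), snd (p n))"] p(1) by simp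
  have "r0 \<le> r + z0 \<bullet> (z - z0)" if "(z, r) \<in> S" for z r
  proof (rule ccontr)
    assume neg: "\<not> r0 \<le> r + z0 \<bullet> (z - z0)"
    define a where "a = r - r0 + z0 \<bullet> (z - z0)"
    define b where "b = (z - z0) \<bullet> (z - z0)"
    have "a < 0" "0 \<le> b" using neg by (auto simp: a_def b_def)
    \<comment> \<open>A negative slope \<open>a\<close> at the minimizer would beat the quadratic remainder \<open>t\<^sup>2 * b / 2\<close>
      for this \<open>t\<close>.\<close>
    define t where "t = min 1 (- a / (b + 1))"
    have "0 < - a / (b + 1)" using \<open>a < 0\<close> \<open>0 \<le> b\<close> by (intro divide_pos_pos) auto
    then have t: "0 < t" "t \<le> 1" "t \<le> - a / (b + 1)"
      unfolding t_def by (simp_all only: min_less_iff_conj min.cobounded1 min.cobounded2 zero_less_one)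
    let ?q = "(1 - t) *\<^sub>R (z0, r0) + t *\<^sub>R (z, r)"
    have "?q \<in> S"
      using \<open>convex S\<close> mem that t by (intro convexD) auto
    then have "m \<le> \<phi> ?q" by (rule m_le)
    also have "\<phi> ?q = m + t * (a + t * b / 2)"
      by (simp add: \<phi>_def r0_def a_def b_def power2_norm_eq_inner inner_diff_left inner_diff_right inner_add_left
          inner_add_right inner_commute field_simps power2_eq_square)
    finally have "0 \<le> a + t * b / 2" using t by (simp add: zero_le_mult_iff)
    moreover have "t * (b + 1) \<le> - a" using t \<open>0 \<le> b\<close> by (simp add: field_simps)
    moreover have "0 \<le> t * b" using t \<open>0 \<le> b\<close> by simp
    ultimately show False using t by (simp add: algebra_simps)
  qed
  with mem that show ?thesis by blast
qed

text \<open>Minimizing \<open>|q - u|\<^sup>2\<close> over \<open>F\<close> is the same as minimizing \<open>|q|\<^sup>2 / 2 - u \<bullet> q\<close>, and the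
  subgradient inequality is then the obtuse angle condition. That condition yields a Pythagorean
  inequality, hence uniqueness of the closest point, so the choice operator in
  \<^const>\<open>proj_onto\<close> picks this very point.\<close>

lemma hilbert_projection:
  fixes F :: "'u::{real_inner,complete_space} set"
  assumes "closed F" "convex F" "F \<noteq> {}"
  shows "proj_onto F u \<in> F"
    and "q \<in> F \<Longrightarrow> (u - proj_onto F u) \<bullet> (q - proj_onto F u) \<le> 0"
proof -
  define S where "S = {(q, r :: real). q \<in> F \<and> - (u \<bullet> q) \<le> r}"
  have "S = (F \<times> UNIV) \<inter> {p. - (u \<bullet> fst p) \<le> snd p}"
    by (auto simp: S_def)
  then have "closed S"
    using \<open>closed F\<close>
    by (auto intro!: closed_Int closed_Times closed_Collect_le continuous_intros)
  have "convex S"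
  proof (rule convexI, clarsimp simp: S_def, intro conjI)
    fix x y :: 'u and r s a b :: real
    assume as: "x \<in> F" "y \<in> F" "- (u \<bullet> x) \<le> r" "- (u \<bullet> y) \<le> s" "0 \<le> a" "0 \<le> b" "a + b = 1"
    then show "a *\<^sub>R x + b *\<^sub>R y \<in> F" using \<open>convex F\<close> by (auto intro: convexD)
    show "- (u \<bullet> (a *\<^sub>R x + b *\<^sub>R y)) \<le> a * r + b * s"
      using mult_left_mono[OF as(3,5)] mult_left_mono[OF as(4,6)]
      by (simp add: inner_add_right)
  qed
  have "S \<noteq> {}" using \<open>F \<noteq> {}\<close> by (auto simp: S_def)
  have lb: "- (u \<bullet> u) / 2 \<le> r + (z \<bullet> z) / 2" if "(z, r) \<in> S" for z r
  proof -
    have "0 \<le> (z - u) \<bullet> (z - u)" by simp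
    then show ?thesis using that
      by (simp add: S_def inner_diff_left inner_diff_right inner_commute)
  qed
  obtain p r0 where "(p, r0) \<in> S" "\<And>z r. (z, r) \<in> S \<Longrightarrow> r0 \<le> r + p \<bullet> (z - p)"
    using quadratic_minimizer[OF \<open>closed S\<close> \<open>convex S\<close> \<open>S \<noteq> {}\<close> lb] by blast
  then have p: "p \<in> F" and "\<And>q. q \<in> F \<Longrightarrow> - (u \<bullet> p) \<le> - (u \<bullet> q) + p \<bullet> (q - p)"
    by (fastforce simp: S_def)+
  then have vi: "(u - p) \<bullet> (q - p) \<le> 0" if "q \<in> F" for q
    using that by (fastforce simp: inner_diff_left inner_diff_right)
  have pyth: "(dist u p)\<^sup>2 + (norm (q - p))\<^sup>2 \<le> (dist u q)\<^sup>2" if "q \<in> F" for q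
    using vi[OF that]
    by (simp add: dist_norm power2_norm_eq_inner inner_diff_left inner_diff_right inner_commute)
  have "p' = p" if "p' \<in> F \<and> (\<forall>q\<in>F. dist u p' \<le> dist u q)" for p'
  proof -
    have "(dist u p')\<^sup>2 \<le> (dist u p)\<^sup>2" using that p by (intro power_mono) auto
    then have "(norm (p' - p))\<^sup>2 \<le> 0" using pyth[of p'] that by linarith
    then show ?thesis by simp
  qed
  moreover have "\<forall>q\<in>F. dist u p \<le> dist u q"
  proof
    fix q assume "q \<in> F"
    then have "(dist u p)\<^sup>2 \<le> (dist u q)\<^sup>2" using pyth[of q] zero_le_power2[of "norm (q - p)"] by linarith
    then show "dist u p \<le> dist u q" by (rule power2_le_imp_le) simp
  qed
  ultimately have "proj_onto F u = p"
    unfolding proj_onto_def using p by (intro some_equality) blast+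
  with p vi show "proj_onto F u \<in> F"
    "q \<in> F \<Longrightarrow> (u - proj_onto F u) \<bullet> (q - proj_onto F u) \<le> 0" by auto
qed

lemma proj_onto_firmly_nonexpansive:
  fixes F :: "'u::{real_inner,complete_space} set"
  assumes "closed F" "convex F" "F \<noteq> {}"
  shows "(norm (proj_onto F a - proj_onto F b))\<^sup>2 \<le> (proj_onto F a - proj_onto F b) \<bullet> (a - b)"
  using hilbert_projection(2)[OF assms hilbert_projection(1)[OF assms, of b], of a]
    hilbert_projection(2)[OF assms hilbert_projection(1)[OF assms, of a], of b]
  by (simp add: power2_norm_eq_inner inner_diff_left inner_diff_right inner_commute)

lemma proj_onto_nonexpansive:
  fixes F :: "'u::{real_inner,complete_space} set"
  assumes "closed F" "convex F" "F \<noteq> {}"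
  shows "norm (proj_onto F a - proj_onto F b) \<le> norm (a - b)"
proof -
  have "(norm (proj_onto F a - proj_onto F b))\<^sup>2 \<le> norm (proj_onto F a - proj_onto F b) * norm (a - b)"
    using proj_onto_firmly_nonexpansive[OF assms] norm_cauchy_schwarz order_trans by blast
  then show ?thesis
    by (cases "proj_onto F a = proj_onto F b") (simp_all add: power2_eq_square)
qed

lemma proj_onto_self:
  "u \<in> F \<Longrightarrow> proj_onto F u = u"
  unfolding proj_onto_def
  by (rule some_equality) (simp, metis dist_self dist_le_zero_iff)

text \<open>If \<open>u\<close> differed from its projection, one could move from the projection a little towards \<open>u\<close>
  without leaving \<open>F\<close>. In the closed loop this says that the saturation is inactive
  once the saturated control is close to \<open>us\<close>.\<close>

lemma proj_onto_interior:
  fixes F :: "'u::{real_inner,complete_space} set"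
  assumes "closed F" "convex F" "proj_onto F u \<in> interior F"
  shows "proj_onto F u = u"
proof (rule ccontr)
  let ?p = "proj_onto F u"
  assume ne: "?p \<noteq> u"
  obtain e where e: "e > 0" "cball ?p e \<subseteq> F"
    using assms(3) by (auto simp: mem_interior_cball)
  \<comment> \<open>The step length that reaches the boundary of the ball around the projection.\<close>
  define s where "s = e / norm (u - ?p)"
  have s: "s > 0" using e ne by (simp add: s_def)
  have "?p + s *\<^sub>R (u - ?p) \<in> cball ?p e"
    using e ne by (simp add: s_def dist_norm)
  then have "(u - ?p) \<bullet> (s *\<^sub>R (u - ?p)) \<le> 0"
    using hilbert_projection(2)[OF assms(1,2), of "?p + s *\<^sub>R (u - ?p)" u] e by fastforce
  then have "(u - ?p) \<bullet> (u - ?p) \<le> 0" using s by (simp add: mult_le_0_iff)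
  then have "u - ?p = 0" by (metis inner_ge_zero antisym inner_eq_zero_iff)
  then show False using ne by simp
qed

text \<open>The minimizer \<open>y\<close> of \<open>|z|\<^sup>2 / 2 - f z\<close> represents \<open>f\<close>.\<close>

lemma riesz_representation:
  fixes f :: "'a::{real_inner,complete_space} \<Rightarrow> real"
  assumes "bounded_linear f"
  shows "\<exists>y. \<forall>x. f x = x \<bullet> y"
proof -
  interpret f: bounded_linear f by fact
  obtain K where K: "\<And>x. \<bar>f x\<bar> \<le> norm x * K" using f.bounded by auto
  define S where "S = {(z, r). - f z \<le> r}"
  have "S = {p. - f (fst p) \<le> snd p}" by (auto simp: S_def)
  then have "closed S"
    by (auto intro!: closed_Collect_le continuous_intros f.continuous_on)
  have "convex S"
  proof (rule convexI, clarsimp simp: S_def f.add f.scaleR)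
    fix x y :: 'a and r s a b :: real
    assume as: "- f x \<le> r" "- f y \<le> s" "0 \<le> a" "0 \<le> b"
    show "- (a * f x) - b * f y \<le> a * r + b * s"
      using mult_left_mono[OF as(1,3)] mult_left_mono[OF as(2,4)] by simp
  qed
  have "S \<noteq> {}" by (auto simp: S_def)
  have lb: "- K\<^sup>2 / 2 \<le> r + (z \<bullet> z) / 2" if "(z, r) \<in> S" for z r
  proof -
    have "0 \<le> (norm z - K)\<^sup>2" by simp
    then have "- K\<^sup>2 / 2 \<le> - (norm z * K) + (norm z)\<^sup>2 / 2" by (simp add: power2_diff)
    also have "\<dots> \<le> r + (z \<bullet> z) / 2"
      using that K[of z] by (simp add: S_def power2_norm_eq_inner)
    finally show ?thesis .
  qed
  obtain y r0 where y: "(y, r0) \<in> S" "\<And>z r. (z, r) \<in> S \<Longrightarrow> r0 \<le> r + y \<bullet> (z - y)"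
    using quadratic_minimizer[OF \<open>closed S\<close> \<open>convex S\<close> \<open>S \<noteq> {}\<close> lb] by blast
  have "- f y \<le> - f z + y \<bullet> (z - y)" for z
    using y(1) y(2)[of z "- f z"] by (simp add: S_def)
  from this[of "y + _"] have le: "f x \<le> y \<bullet> x" for x by (simp add: f.add)
  have "f x = x \<bullet> y" for x
    using le[of x] le[of "- x"] by (simp add: f.neg inner_commute)
  then show ?thesis by blast
qed

text \<open>\<^const>\<open>adjoint\<close> is a choice among all adjoint maps; the Riesz theorem provides one.\<close>

lemma adjoint_hilbert:
  fixes B :: "'u::{real_inner,complete_space} \<Rightarrow> 'x::real_inner"
  assumes "bounded_linear B"
  shows "B u \<bullet> x = u \<bullet> adjoint B x"
proof -
  have "\<exists>y. \<forall>u. B u \<bullet> x = u \<bullet> y" for x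
    by (rule riesz_representation)
      (rule bounded_linear_compose[OF bounded_linear_inner_left assms])
  then have "\<exists>f'. \<forall>u x. B u \<bullet> x = u \<bullet> f' x" by metis
  then show ?thesis
    unfolding adjoint_def by (rule someI2_ex) blast
qed

lemma bounded_linear_adjoint_hilbert:
  fixes B :: "'u::{real_inner,complete_space} \<Rightarrow> 'x::real_inner"
  assumes "bounded_linear B"
  shows "bounded_linear (adjoint B)"
proof -
  obtain K where K: "\<And>u. norm (B u) \<le> norm u * K" using bounded_linear.bounded[OF assms] by blast
  show ?thesis
  proof (rule bounded_linear_intro)
    fix x y :: 'x and c :: real
    show "adjoint B (x + y) = adjoint B x + adjoint B y"
      by (rule vector_eq_ldot[THEN iffD1])
        (simp add: adjoint_hilbert[OF assms, symmetric] inner_add_right)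
    show "adjoint B (c *\<^sub>R x) = c *\<^sub>R adjoint B x"
      by (rule vector_eq_ldot[THEN iffD1])
        (simp add: adjoint_hilbert[OF assms, symmetric])
    let ?y = "adjoint B x"
    have "(norm ?y)\<^sup>2 = B ?y \<bullet> x" by (simp add: adjoint_hilbert[OF assms] power2_norm_eq_inner)
    also have "\<dots> \<le> norm (B ?y) * norm x" by (rule norm_cauchy_schwarz)
    also have "\<dots> \<le> norm ?y * K * norm x" by (intro mult_right_mono K) simp
    finally have *: "norm ?y * norm ?y \<le> norm ?y * (norm x * K)"
      by (simp add: power2_eq_square ac_simps)
    show "norm ?y \<le> norm x * \<bar>K\<bar>"
    proof (cases "?y = 0")
      case False
      then have "norm ?y \<le> norm x * K" using * by simp
      also have "\<dots> \<le> norm x * \<bar>K\<bar>" by (intro mult_left_mono) auto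
      finally show ?thesis .
    qed simp
  qed
qed

section \<open>Surjectivity for maximal monotone operators\<close>

text \<open>This is the theorem of Minty in the form \<open>0 \<in> range (I + G)\<close>. The set \<open>S\<close> below is the
  epigraph of the Fitzpatrick function \<open>f(x, v) = sup {b \<bullet> x + a \<bullet> v - a \<bullet> b | (a, b) \<in> G}\<close>.
  Monotonicity gives \<open>f(a, b) \<le> a \<bullet> b\<close> on \<open>G\<close>, and maximality gives \<open>x \<bullet> v \<le> f(x, v)\<close>
  everywhere, so that \<open>f(x, v) + (|x|\<^sup>2 + |v|\<^sup>2) / 2 \<ge> |x + v|\<^sup>2 / 2 \<ge> 0\<close>. The subgradient
  inequality at the minimizer \<open>(x, v)\<close>, tested at points of \<open>G\<close>, shows that \<open>(-v, -x)\<close> is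
  monotonically related to \<open>G\<close> with the surplus \<open>|x + v|\<^sup>2\<close>. By maximality \<open>(-v, -x)\<close> lies
  in \<open>G\<close>, and testing with this point itself makes the surplus vanish.\<close>

lemma maximal_monotone_graph_meets_antidiagonal:
  fixes G :: "('x::{real_inner,complete_space} \<times> 'x) set"
  assumes mono: "monotone_graph G" and "G \<noteq> {}"
    and max: "\<And>x v. (\<And>a b. (a, b) \<in> G \<Longrightarrow> 0 \<le> (v - b) \<bullet> (x - a)) \<Longrightarrow> (x, v) \<in> G"
  shows "\<exists>x. (x, - x) \<in> G"
proof -
  define S where "S = {((x, v), r). \<forall>(a, b)\<in>G. b \<bullet> x + a \<bullet> v - a \<bullet> b \<le> r}"
  have "S = (\<Inter>(a, b)\<in>G. {p. b \<bullet> fst (fst p) + a \<bullet> snd (fst p) - a \<bullet> b \<le> snd p})"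
    by (auto simp: S_def)
  then have "closed S"
    by (auto intro!: closed_INT closed_Collect_le continuous_intros)
  have "convex S"
  proof (rule convexI, clarsimp simp: S_def)
    fix x v y w a b :: 'x and r s \<alpha> \<beta> :: real
    assume as: "\<forall>(a, b)\<in>G. b \<bullet> x + a \<bullet> v - a \<bullet> b \<le> r" "\<forall>(a, b)\<in>G. b \<bullet> y + a \<bullet> w - a \<bullet> b \<le> s"
      "0 \<le> \<alpha>" "0 \<le> \<beta>" "\<alpha> + \<beta> = 1" "(a, b) \<in> G"
    have "\<alpha> * (b \<bullet> x + a \<bullet> v - a \<bullet> b) + \<beta> * (b \<bullet> y + a \<bullet> w - a \<bullet> b) \<le> \<alpha> * r + \<beta> * s"
      using as by (intro add_mono mult_left_mono) auto
    moreover have "a \<bullet> b = (\<alpha> + \<beta>) * (a \<bullet> b)" using as by simp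
    ultimately show "b \<bullet> (\<alpha> *\<^sub>R x + \<beta> *\<^sub>R y) + a \<bullet> (\<alpha> *\<^sub>R v + \<beta> *\<^sub>R w) - a \<bullet> b \<le> \<alpha> * r + \<beta> * s"
      by (simp add: inner_add_right algebra_simps)
  qed
  have graph_S: "((a, b), a \<bullet> b) \<in> S" if "(a, b) \<in> G" for a b
    using mono that unfolding S_def monotone_graph_def
    by (fastforce simp: inner_diff_left inner_diff_right inner_commute)
  then have "S \<noteq> {}" using \<open>G \<noteq> {}\<close> by auto
  have fitz: "x \<bullet> v \<le> r" if "((x, v), r) \<in> S" for x v r
  proof (cases "(x, v) \<in> G")
    case True
    then have "v \<bullet> x + x \<bullet> v - x \<bullet> v \<le> r" using that by (auto simp: S_def)
    then show ?thesis by (simp add: inner_commute)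
  next
    case False
    then obtain a b where "(a, b) \<in> G" "(v - b) \<bullet> (x - a) < 0" using max not_le by blast
    moreover from this(1) have "b \<bullet> x + a \<bullet> v - a \<bullet> b \<le> r" using that by (auto simp: S_def)
    ultimately show ?thesis by (simp add: inner_diff_left inner_diff_right inner_commute)
  qed
  have lb: "0 \<le> r + (z \<bullet> z) / 2" if "(z, r) \<in> S" for z r
  proof -
    obtain x v where z: "z = (x, v)" by fastforce
    have "0 \<le> (x + v) \<bullet> (x + v)" by simp
    then show ?thesis
      using fitz[of x v r] that by (simp add: z inner_add_left inner_add_right inner_commute field_simps)
  qed
  obtain z0 r0 where z0: "(z0, r0) \<in> S" "\<And>z r. (z, r) \<in> S \<Longrightarrow> r0 \<le> r + z0 \<bullet> (z - z0)"
    using quadratic_minimizer[OF \<open>closed S\<close> \<open>convex S\<close> \<open>S \<noteq> {}\<close> lb] by blast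
  obtain x v where xv: "z0 = (x, v)" by fastforce
  have key: "(norm (x + v))\<^sup>2 \<le> (- x - b) \<bullet> (- v - a)" if "(a, b) \<in> G" for a b
  proof -
    have "x \<bullet> v \<le> a \<bullet> b + (x \<bullet> (a - x) + v \<bullet> (b - v))"
      using fitz[of x v r0] z0(1) z0(2)[OF graph_S[OF that]] by (simp add: xv)
    then show ?thesis
      by (simp add: power2_norm_eq_inner inner_add_left inner_add_right inner_diff_left
          inner_diff_right inner_commute)
  qed
  have "(- v, - x) \<in> G"
    by (rule max) (use key in \<open>fastforce intro: order_trans[OF zero_le_power2]\<close>)
  then have "(norm (x + v))\<^sup>2 \<le> 0" using key by fastforce
  then have "v = - x" by (simp add: add_eq_0_iff)
  with \<open>(- v, - x) \<in> G\<close> show ?thesis by auto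
qed

text \<open>Scaling \<open>M\<close> by \<open>h\<close> and subtracting \<open>y\<close> preserves monotonicity and maximality of the graph,
  which reduces the claim to a zero of \<open>I + G\<close>.\<close>

lemma minty_surjectivity:
  fixes D :: "'x::{real_inner,complete_space} set"
  assumes max: "maximal_monotone D M" and "D \<noteq> {}" and "h > 0"
  shows "\<exists>x\<in>D. x + h *\<^sub>R M x = y"
proof -
  have mono: "0 \<le> (M x - M z) \<bullet> (x - z)" if "x \<in> D" "z \<in> D" for x z
    using max that by (fastforce simp: maximal_monotone_def monotone_graph_def op_graph_def)
  have maxD: "x \<in> D \<and> v = M x" if "\<And>a. a \<in> D \<Longrightarrow> 0 \<le> (v - M a) \<bullet> (x - a)" for x v
  proof -
    have "monotone_graph (insert (x, v) (op_graph D M))"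
      unfolding monotone_graph_def op_graph_def
      by (auto simp: mono that) (use that in \<open>metis inner_minus_left inner_minus_right minus_diff_eq minus_minus\<close>)
    then have "insert (x, v) (op_graph D M) = op_graph D M"
      using max unfolding maximal_monotone_def by blast
    then show ?thesis by (auto simp: op_graph_def)
  qed
  define G where "G = {(x, h *\<^sub>R M x - y) | x. x \<in> D}"
  have "\<exists>x. (x, - x) \<in> G"
  proof (rule maximal_monotone_graph_meets_antidiagonal)
    show "monotone_graph G"
      using mono \<open>h > 0\<close>
      by (auto simp: monotone_graph_def G_def simp flip: scaleR_diff_right)
    show "G \<noteq> {}" using \<open>D \<noteq> {}\<close> by (auto simp: G_def)
    fix x v
    assume rel: "\<And>a b. (a, b) \<in> G \<Longrightarrow> 0 \<le> (v - b) \<bullet> (x - a)"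
    have "0 \<le> ((v + y) /\<^sub>R h - M a) \<bullet> (x - a)" if "a \<in> D" for a
    proof -
      have "(v + y) /\<^sub>R h - M a = (v - (h *\<^sub>R M a - y)) /\<^sub>R h"
        using \<open>h > 0\<close> by (simp add: algebra_simps)
      then show ?thesis using rel[of a "h *\<^sub>R M a - y"] that \<open>h > 0\<close> by (auto simp: G_def)
    qed
    from maxD[OF this] have "x \<in> D" "(v + y) /\<^sub>R h = M x" by simp_all
    moreover from this(2)[symmetric] have "h *\<^sub>R M x = v + y" using \<open>h > 0\<close> by simp
    ultimately show "(x, v) \<in> G" by (auto simp: G_def)
  qed
  then show ?thesis by (fastforce simp: G_def algebra_simps)
qed

section \<open>The exponential formula\<close>

text \<open>The bound \<open>h\<^sub>0\<close> on the step size suits the closed loop, for which a contraction argument solves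
  the resolvent equation for small \<open>h\<close>; the steps \<open>t / n\<close> of the exponential formula are
  eventually below any such bound.\<close>

locale resolvent_scheme =
  fixes D :: "'x::{real_inner,complete_space} set" and W :: "'x \<Rightarrow> 'x" and h\<^sub>0 :: real
  assumes h\<^sub>0_pos: "0 < h\<^sub>0"
    and monotone: "\<And>x z. x \<in> D \<Longrightarrow> z \<in> D \<Longrightarrow> 0 \<le> (W x - W z) \<bullet> (x - z)"
    and small_step_range: "\<And>h y. 0 < h \<Longrightarrow> h < h\<^sub>0 \<Longrightarrow> \<exists>x\<in>D. x + h *\<^sub>R W x = y"
begin

abbreviation J where "J \<equiv> resolvent D W"
abbreviation S where "S \<equiv> generated_semigroup D W"

lemma expansive:
  assumes "0 \<le> h" "x \<in> D" "z \<in> D"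
  shows "norm (x - z) \<le> norm ((x + h *\<^sub>R W x) - (z + h *\<^sub>R W z))"
proof -
  have "(norm (x - z))\<^sup>2 \<le> (norm (x - z))\<^sup>2 + 2 * h * ((W x - W z) \<bullet> (x - z)) + (norm (h *\<^sub>R (W x - W z)))\<^sup>2"
    using assms monotone by simp
  also have "\<dots> = (norm ((x - z) + h *\<^sub>R (W x - W z)))\<^sup>2"
    by (simp only: power2_norm_eq_inner) (simp add: inner_add_left inner_add_right inner_commute)
  also have "(x - z) + h *\<^sub>R (W x - W z) = (x + h *\<^sub>R W x) - (z + h *\<^sub>R W z)"
    by (simp add: algebra_simps)
  finally show ?thesis by (rule power2_le_imp_le) simp
qed

lemma resolvent_solves:
  assumes "0 < h" "h < h\<^sub>0"
  shows "J h y \<in> D" "J h y + h *\<^sub>R W (J h y) = y"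
proof -
  have inj: "inj_on (\<lambda>x. x + h *\<^sub>R W x) D"
  proof (rule inj_onI)
    fix x z
    assume "x \<in> D" "z \<in> D" "x + h *\<^sub>R W x = z + h *\<^sub>R W z"
    then show "x = z" using expansive[of h x z] assms by simp
  qed
  have "y \<in> (\<lambda>x. x + h *\<^sub>R W x) ` D" using small_step_range[OF assms, of y] by force
  then show "J h y \<in> D" "J h y + h *\<^sub>R W (J h y) = y"
    using the_inv_into_into[OF inj _ subset_refl] f_the_inv_into_f[OF inj]
    by (simp_all add: resolvent_def)
qed

lemma resolvent_nonexpansive:
  assumes "0 < h" "h < h\<^sub>0"
  shows "norm (J h y - J h z) \<le> norm (y - z)"
  using expansive[of h "J h y" "J h z"] assms by (simp add: resolvent_solves)

lemma iterate_nonexpansive: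
  assumes "0 < h" "h < h\<^sub>0"
  shows "norm ((J h ^^ n) y - (J h ^^ n) z) \<le> norm (y - z)"
proof (induction n)
  case (Suc n)
  then show ?case
    using resolvent_nonexpansive[OF assms, of "(J h ^^ n) y" "(J h ^^ n) z"] by simp
qed simp

lemma iterate_displacement:
  assumes "0 < h" "h < h\<^sub>0" "x \<in> D"
  shows "norm ((J h ^^ n) x - x) \<le> real n * h * norm (W x)"
proof (induction n)
  case (Suc n)
  have "norm (J h x - x) \<le> norm (x - (x + h *\<^sub>R W x))"
    using expansive[of h "J h x" x] resolvent_solves[OF assms(1,2), of x] assms by simp
  then have step: "norm (J h x - x) \<le> h * norm (W x)" using assms by simp
  have "norm ((J h ^^ Suc n) x - x) \<le> norm ((J h ^^ n) (J h x) - (J h ^^ n) x) + norm ((J h ^^ n) x - x)"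
    using norm_triangle_ineq[of "(J h ^^ n) (J h x) - (J h ^^ n) x" "(J h ^^ n) x - x"]
    by (simp add: funpow_swap1)
  also have "\<dots> \<le> h * norm (W x) + real n * h * norm (W x)"
    using iterate_nonexpansive[OF assms(1,2), of n "J h x" x] step Suc.IH by linarith
  finally show ?case by (simp add: algebra_simps)
qed simp

text \<open>Test the monotonicity of \<open>W\<close> at \<open>J l p\<close> and \<open>J u q\<close>, where \<open>W\<close> is given by the difference
  quotients, and apply Young's inequality. The weights \<open>u\<close> and \<open>l\<close> are those for which the
  estimate below is reproduced exactly.\<close>

lemma resolvent_two_steps:
  assumes "0 < l" "l < h\<^sub>0" "0 < u" "u < h\<^sub>0"
  shows "(l + u) * (norm (J l p - J u q))\<^sup>2
    \<le> u * (norm (p - J u q))\<^sup>2 + l * (norm (J l p - q))\<^sup>2"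
proof -
  let ?d = "J l p - J u q"
  let ?a = "p - J u q" and ?b = "J l p - q"
  have W: "l *\<^sub>R W (J l p) = p - J l p" "u *\<^sub>R W (J u q) = q - J u q"
    using resolvent_solves(2)[OF assms(1,2), of p] resolvent_solves(2)[OF assms(3,4), of q]
    by (metis add_diff_cancel_left')+
  have "0 \<le> l * u * ((W (J l p) - W (J u q)) \<bullet> ?d)"
    using assms monotone resolvent_solves by simp
  also have "\<dots> = (u *\<^sub>R (l *\<^sub>R W (J l p)) - l *\<^sub>R (u *\<^sub>R W (J u q))) \<bullet> ?d"
    by (simp add: inner_diff_left algebra_simps)
  also have "u *\<^sub>R (l *\<^sub>R W (J l p)) - l *\<^sub>R (u *\<^sub>R W (J u q)) = u *\<^sub>R ?a + l *\<^sub>R ?b - (l + u) *\<^sub>R ?d"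
    unfolding W by (simp add: algebra_simps)
  finally have *: "(l + u) * (norm ?d)\<^sup>2 \<le> u * (?a \<bullet> ?d) + l * (?b \<bullet> ?d)"
    by (simp only: inner_diff_left inner_add_left inner_scaleR_left power2_norm_eq_inner)
  have young: "v \<bullet> w \<le> (norm v)\<^sup>2 / 2 + (norm w)\<^sup>2 / 2" for v w :: 'x
  proof -
    have "0 \<le> (norm (v - w))\<^sup>2" by simp
    then show ?thesis
      by (simp add: power2_norm_eq_inner inner_diff_left inner_diff_right inner_commute field_simps)
  qed
  have "u * (?a \<bullet> ?d) \<le> u * ((norm ?a)\<^sup>2 / 2 + (norm ?d)\<^sup>2 / 2)"
    "l * (?b \<bullet> ?d) \<le> l * ((norm ?b)\<^sup>2 / 2 + (norm ?d)\<^sup>2 / 2)"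
    using assms young by (simp_all add: mult_left_mono)
  with * show ?thesis by (simp only: ring_distribs times_divide_eq_right)
qed

text \<open>Double induction. On the boundary (\<open>m = 0\<close> or \<open>n = 0\<close>) this is the displacement bound. In the
  induction step write \<open>c m n\<close> for the bracket and \<open>\<sigma> = m * l - n * u\<close>; then
  \<open>c (m - 1) n = c m n - 2 * \<sigma> * l\<close> and \<open>c m (n - 1) = c m n + 2 * \<sigma> * u\<close>, and the combination with
  weights \<open>u\<close> and \<open>l\<close> cancels \<open>\<sigma>\<close>. The estimate compares Euler schemes with different step sizes
  and different final times, so it yields both convergence of the exponential formula and
  Lipschitz continuity in time.\<close>

lemma kobayashi_estimate:
  assumes "0 < l" "l < h\<^sub>0" "0 < u" "u < h\<^sub>0" "x \<in> D"
  shows "(norm ((J l ^^ m) x - (J u ^^ n) x))\<^sup>2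
    \<le> (norm (W x))\<^sup>2 * ((real m * l - real n * u)\<^sup>2 + real m * l\<^sup>2 + real n * u\<^sup>2)"
    (is "?a m n \<le> ?L * ?c m n")
proof (induction m arbitrary: n)
  case 0
  have "?a 0 n \<le> (real n * u * norm (W x))\<^sup>2"
    using iterate_displacement[OF assms(3-5), of n]
    by (simp add: norm_minus_commute power_mono)
  also have "\<dots> = ?L * (real n * u)\<^sup>2" by (simp add: power_mult_distrib)
  also have "\<dots> \<le> ?L * ?c 0 n" by (intro mult_left_mono) auto
  finally show ?case .
next
  case (Suc m)
  note outer = Suc.IH
  show ?case
  proof (induction n)
    case 0
    have "?a (Suc m) 0 \<le> (real (Suc m) * l * norm (W x))\<^sup>2"
      using iterate_displacement[OF assms(1,2,5), of "Suc m"] by (intro power_mono) auto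
    also have "\<dots> = ?L * (real (Suc m) * l)\<^sup>2" by (simp add: power_mult_distrib)
    also have "\<dots> \<le> ?L * ?c (Suc m) 0" by (intro mult_left_mono) auto
    finally show ?case .
  next
    case (Suc n)
    have "(l + u) * ?a (Suc m) (Suc n) \<le> u * ?a m (Suc n) + l * ?a (Suc m) n"
      using resolvent_two_steps[OF assms(1-4), of "(J l ^^ m) x" "(J u ^^ n) x"] by simp
    also have "\<dots> \<le> u * (?L * ?c m (Suc n)) + l * (?L * ?c (Suc m) n)"
      using outer[of "Suc n"] Suc.IH assms by (intro add_mono mult_left_mono) auto
    also have "\<dots> = (l + u) * (?L * ?c (Suc m) (Suc n))"
      by (simp add: algebra_simps power2_eq_square)
    finally show ?case using assms by simp
  qed
qed

lemma eventually_small_step: "0 < t \<Longrightarrow> eventually (\<lambda>n. 0 < t / real n \<and> t / real n < h\<^sub>0) sequentially"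
  using order_tendstoD(2)[OF lim_const_over_n[of t] h\<^sub>0_pos] eventually_gt_at_top[of 0]
  by eventually_elim auto

text \<open>With \<open>l = t / m\<close> and \<open>u = t / n\<close> both schemes end at time \<open>t\<close>, so the difference of the final times
  drops out of the Kobayashi bound and \<open>t\<^sup>2 / m + t\<^sup>2 / n\<close> remains.\<close>

lemma Cauchy_exponential_formula_domain:
  assumes "0 < t" "x \<in> D"
  shows "Cauchy (\<lambda>n. (J (t / real n) ^^ n) x)"
proof (rule metric_CauchyI)
  fix e :: real
  assume "0 < e"
  define c where "c = 2 * (norm (W x))\<^sup>2 * t\<^sup>2"
  have "0 \<le> c" by (simp add: c_def)
  have "eventually (\<lambda>n. c / real n < e\<^sup>2) sequentially"
    by (rule order_tendstoD(2)[OF lim_const_over_n]) (use \<open>0 < e\<close> in simp)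
  with eventually_small_step[OF \<open>0 < t\<close>] eventually_gt_at_top[of 0]
  have "eventually (\<lambda>n. 0 < n \<and> t / real n < h\<^sub>0 \<and> c / real n < e\<^sup>2) sequentially"
    by eventually_elim auto
  then obtain N where N: "0 < N" "t / real N < h\<^sub>0" "c / real N < e\<^sup>2"
    by (auto simp: eventually_sequentially)
  have "dist ((J (t / real m) ^^ m) x) ((J (t / real n) ^^ n) x) < e" if "m \<ge> N" "n \<ge> N" for m n
  proof -
    have mono_N: "a / real k \<le> a / real N" if "k \<ge> N" "0 \<le> a" for a k
      using that N by (intro divide_left_mono) auto
    have small: "0 < t / real k" "t / real k < h\<^sub>0" if "k \<ge> N" for k
      using that N \<open>0 < t\<close> mono_N[OF that, of t] by auto
    have "(a + b) / 2 \<le> M" if "a \<le> M" "b \<le> M" for a b M :: real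
      using that by simp
    then have avg: "(c / real m + c / real n) / 2 \<le> c / real N"
      using mono_N[OF that(1) \<open>0 \<le> c\<close>] mono_N[OF that(2) \<open>0 \<le> c\<close>] by blast
    have "(norm ((J (t / real m) ^^ m) x - (J (t / real n) ^^ n) x))\<^sup>2
      \<le> (norm (W x))\<^sup>2 * ((real m * (t / real m) - real n * (t / real n))\<^sup>2
          + real m * (t / real m)\<^sup>2 + real n * (t / real n)\<^sup>2)"
      using small that \<open>x \<in> D\<close> by (intro kobayashi_estimate) auto
    also have "\<dots> = (c / real m + c / real n) / 2"
      using that N by (simp add: c_def field_simps power2_eq_square)
    also note avg
    also note N(3)
    finally show ?thesis using \<open>0 < e\<close> by (simp add: dist_norm power_less_imp_less_base)
  qed
  then show "\<exists>N. \<forall>m\<ge>N. \<forall>n\<ge>N. dist ((J (t / real m) ^^ m) x) ((J (t / real n) ^^ n) x) < e"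
    by blast
qed

text \<open>Nonexpansive iterates carry the Cauchy property from \<open>D\<close> to its closure.\<close>

lemma Cauchy_exponential_formula:
  assumes "0 < t" "x \<in> closure D"
  shows "Cauchy (\<lambda>n. (J (t / real n) ^^ n) x)"
proof (rule metric_CauchyI)
  fix e :: real
  assume "0 < e"
  obtain z where z: "z \<in> D" "dist z x < e / 3"
    using \<open>x \<in> closure D\<close> \<open>0 < e\<close> by (meson closure_approachable divide_pos_pos zero_less_numeral)
  obtain N\<^sub>1 where N\<^sub>1: "\<And>m n. m \<ge> N\<^sub>1 \<Longrightarrow> n \<ge> N\<^sub>1 \<Longrightarrow>
      dist ((J (t / real m) ^^ m) z) ((J (t / real n) ^^ n) z) < e / 3"
    using metric_CauchyD[OF Cauchy_exponential_formula_domain[OF \<open>0 < t\<close> z(1)], of "e / 3"] \<open>0 < e\<close>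
    by auto
  obtain N\<^sub>2 where N\<^sub>2: "\<And>n. n \<ge> N\<^sub>2 \<Longrightarrow> 0 < t / real n \<and> t / real n < h\<^sub>0"
    using eventually_small_step[OF \<open>0 < t\<close>] by (auto simp: eventually_sequentially)
  have near: "dist ((J (t / real n) ^^ n) x) ((J (t / real n) ^^ n) z) < e / 3" if "n \<ge> N\<^sub>2" for n
    using iterate_nonexpansive[of "t / real n" n x z] N\<^sub>2[OF that] z(2)
    by (simp add: dist_norm norm_minus_commute)
  have "dist ((J (t / real m) ^^ m) x) ((J (t / real n) ^^ n) x) < e"
    if "m \<ge> max N\<^sub>1 N\<^sub>2" "n \<ge> max N\<^sub>1 N\<^sub>2" for m n
    using dist_triangle_third[of "(J (t / real m) ^^ m) x" "(J (t / real m) ^^ m) z" e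
        "(J (t / real n) ^^ n) z" "(J (t / real n) ^^ n) x"]
      near[of m] near[of n] N\<^sub>1[of m n] that by (simp add: dist_commute)
  then show "\<exists>N. \<forall>m\<ge>N. \<forall>n\<ge>N. dist ((J (t / real m) ^^ m) x) ((J (t / real n) ^^ n) x) < e"
    by blast
qed

lemma exponential_formula:
  assumes "0 < t" "x \<in> closure D"
  shows "(\<lambda>n. (J (t / real n) ^^ n) x) \<longlonglongrightarrow> S t x"
  using Cauchy_convergent[OF Cauchy_exponential_formula[OF assms]] assms
  by (simp add: generated_semigroup_def convergent_LIMSEQ_iff)

lemma semigroup_nonexpansive:
  assumes "0 \<le> t" "x \<in> closure D" "z \<in> closure D"
  shows "norm (S t x - S t z) \<le> norm (x - z)"
proof (cases "t = 0")
  case False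
  then have "0 < t" using assms by simp
  show ?thesis
  proof (rule tendsto_upperbound)
    show "(\<lambda>n. norm ((J (t / real n) ^^ n) x - (J (t / real n) ^^ n) z)) \<longlonglongrightarrow> norm (S t x - S t z)"
      using \<open>0 < t\<close> assms by (intro tendsto_intros exponential_formula)
    show "eventually (\<lambda>n. norm ((J (t / real n) ^^ n) x - (J (t / real n) ^^ n) z) \<le> norm (x - z)) sequentially"
      using eventually_small_step[OF \<open>0 < t\<close>] by eventually_elim (simp add: iterate_nonexpansive)
  qed simp
qed (simp add: generated_semigroup_def)

lemma semigroup_displacement:
  assumes "0 \<le> t" "x \<in> D"
  shows "norm (S t x - x) \<le> t * norm (W x)"
proof (cases "t = 0")
  case False
  then have "0 < t" using assms by simp
  have "x \<in> closure D" using assms closure_subset by blast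
  show ?thesis
  proof (rule tendsto_upperbound)
    show "(\<lambda>n. norm ((J (t / real n) ^^ n) x - x)) \<longlonglongrightarrow> norm (S t x - x)"
      using \<open>0 < t\<close> \<open>x \<in> closure D\<close> by (intro tendsto_intros exponential_formula)
    show "eventually (\<lambda>n. norm ((J (t / real n) ^^ n) x - x) \<le> t * norm (W x)) sequentially"
      using eventually_small_step[OF \<open>0 < t\<close>]
    proof eventually_elim
      case (elim n)
      then show ?case using iterate_displacement[of "t / real n" x n] \<open>x \<in> D\<close> by (cases "n = 0") auto
    qed
  qed simp
qed (simp add: generated_semigroup_def)

lemma semigroup_lipschitz:
  assumes "0 \<le> s" "0 \<le> t" "x \<in> D"
  shows "norm (S t x - S s x) \<le> norm (W x) * \<bar>t - s\<bar>"
proof -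
  consider "s = 0" | "t = 0" | "0 < s" "0 < t" using assms by fastforce
  then show ?thesis
  proof cases
    case 1
    then show ?thesis
      using semigroup_displacement[OF assms(2,3)] assms
      by (simp add: generated_semigroup_def mult.commute)
  next
    case 2
    then show ?thesis
      using semigroup_displacement[OF assms(1,3)] assms
      by (simp add: generated_semigroup_def mult.commute norm_minus_commute)
  next
    case 3
    have x: "x \<in> closure D" using assms closure_subset by blast
    let ?b = "\<lambda>n. (norm (W x))\<^sup>2 * ((t - s)\<^sup>2 + t\<^sup>2 / real n + s\<^sup>2 / real n)"
    have "(norm (S t x - S s x))\<^sup>2 \<le> (norm (W x))\<^sup>2 * ((t - s)\<^sup>2 + 0 + 0)"
    proof (rule tendsto_le[OF sequentially_bot])
      show "(\<lambda>n. (norm ((J (t / real n) ^^ n) x - (J (s / real n) ^^ n) x))\<^sup>2) \<longlonglongrightarrow> (norm (S t x - S s x))\<^sup>2"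
        using 3 x by (intro tendsto_intros exponential_formula)
      show "?b \<longlonglongrightarrow> (norm (W x))\<^sup>2 * ((t - s)\<^sup>2 + 0 + 0)"
        by (intro tendsto_intros lim_const_over_n)
      show "eventually (\<lambda>n. (norm ((J (t / real n) ^^ n) x - (J (s / real n) ^^ n) x))\<^sup>2 \<le> ?b n) sequentially"
        using eventually_small_step[OF \<open>0 < t\<close>] eventually_small_step[OF \<open>0 < s\<close>] eventually_gt_at_top[of 0]
      proof eventually_elim
        case (elim n)
        then show ?case
          using kobayashi_estimate[of "t / real n" "s / real n" x n n] \<open>x \<in> D\<close>
          by (simp add: power2_eq_square)
      qed
    qed
    also have "\<dots> = (norm (W x) * \<bar>t - s\<bar>)\<^sup>2" by (simp add: power_mult_distrib)
    finally show ?thesis by (rule power2_le_imp_le) simp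
  qed
qed

section \<open>Energy dissipation along the semigroup\<close>

text \<open>All multiples of \<open>\<delta>\<close> are reached with the common step \<open>\<delta> / n\<close>, as a subsequence of the
  exponential formula. One Euler orbit therefore passes near all grid points at once, so that the
  energy along it can be compared between consecutive grid points.\<close>

lemma exponential_formula_blocks:
  assumes "0 < \<delta>" "x \<in> D"
  shows "(\<lambda>n. (J (\<delta> / real n) ^^ (i * n)) x) \<longlonglongrightarrow> S (real i * \<delta>) x"
proof (cases "i = 0")
  case False
  have x: "x \<in> closure D" using assms closure_subset by blast
  have "strict_mono (\<lambda>n. i * n)" using False by (simp add: strict_mono_def)
  from LIMSEQ_subseq_LIMSEQ[OF exponential_formula[OF _ x, of "real i * \<delta>"] this]
  show ?thesis using False assms by (simp add: o_def)
qed (simp add: generated_semigroup_def)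

text \<open>Each implicit Euler step dissipates at least \<open>h * |g|\<^sup>2\<close> of the energy \<open>|x - xs|\<^sup>2 / 2\<close>. Within
  \<open>n\<close> steps the orbit moves by at most \<open>n * h * |W x|\<close>, so \<open>|g|\<^sup>2\<close> stays above the maximum on the
  left, which is expressed through the value of \<open>g\<close> at the beginning of the block.\<close>

lemma dissipation_block:
  fixes g :: "'x \<Rightarrow> 'u::real_normed_vector"
  assumes diss: "\<And>x. x \<in> D \<Longrightarrow> (norm (g x))\<^sup>2 \<le> W x \<bullet> (x - xs)"
    and lip: "\<And>x z. norm (g x - g z) \<le> K * norm (x - z)" and "0 \<le> K"
    and h: "0 < h" "h < h\<^sub>0" and "x \<in> D"
  shows "real n * h * max 0 ((norm (g ((J h ^^ k) x)))\<^sup>2 / 2 - (K * (real n * h * norm (W x)))\<^sup>2)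
    \<le> (norm ((J h ^^ k) x - xs))\<^sup>2 / 2 - (norm ((J h ^^ (k + n)) x - xs))\<^sup>2 / 2"
proof -
  let ?y = "\<lambda>j. (J h ^^ j) x"
  define c where "c = max 0 ((norm (g (?y k)))\<^sup>2 / 2 - (K * (real n * h * norm (W x)))\<^sup>2)"
  have step: "h * (norm (g (J h p)))\<^sup>2 \<le> (norm (p - xs))\<^sup>2 / 2 - (norm (J h p - xs))\<^sup>2 / 2" for p
  proof -
    let ?q = "J h p"
    \<comment> \<open>The implicit Euler equation, shifted by \<open>xs\<close>; expanding the square of its norm produces the
      dissipation term.\<close>
    have p: "p - xs = (?q - xs) + h *\<^sub>R W ?q" using resolvent_solves(2)[OF h, of p] by (simp add: algebra_simps)
    have "(norm (p - xs))\<^sup>2 = (norm (?q - xs))\<^sup>2 + 2 * (h * (W ?q \<bullet> (?q - xs))) + (norm (h *\<^sub>R W ?q))\<^sup>2"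
      unfolding p by (simp only: power2_norm_eq_inner inner_add_left inner_add_right inner_scaleR_left inner_scaleR_right inner_commute)
    moreover have "h * (norm (g ?q))\<^sup>2 \<le> h * (W ?q \<bullet> (?q - xs))"
      using diss[OF resolvent_solves(1)[OF h]] h by simp
    moreover have "0 \<le> (norm (h *\<^sub>R W ?q))\<^sup>2" by simp
    ultimately show ?thesis by argo
  qed
  have slow: "c \<le> (norm (g (?y (k + j))))\<^sup>2" if "j \<le> n" for j
  proof -
    have "norm (?y (k + j) - ?y k) \<le> norm (?y j - x)"
      using iterate_nonexpansive[OF h, of k "?y j" x] by (simp add: funpow_add)
    also have "\<dots> \<le> real j * h * norm (W x)" by (rule iterate_displacement[OF h \<open>x \<in> D\<close>])
    also have "\<dots> \<le> real n * h * norm (W x)" using that h by (intro mult_right_mono) auto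
    finally have "norm (g (?y (k + j)) - g (?y k)) \<le> K * (real n * h * norm (W x))"
      using lip[of "?y (k + j)" "?y k"] \<open>0 \<le> K\<close> mult_left_mono order_trans by blast
    then have "norm (g (?y k)) \<le> norm (g (?y (k + j))) + K * (real n * h * norm (W x))"
      using norm_triangle_ineq2[of "g (?y k)" "g (?y (k + j))"] by (simp add: norm_minus_commute)
    then have "(norm (g (?y k)))\<^sup>2 \<le> (norm (g (?y (k + j))) + K * (real n * h * norm (W x)))\<^sup>2"
      by (rule power_mono) simp
    moreover have "(a + b)\<^sup>2 \<le> 2 * a\<^sup>2 + 2 * b\<^sup>2" for a b :: real
      using zero_le_power2[of "a - b"] by (simp add: power2_diff power2_sum)
    ultimately have "(norm (g (?y k)))\<^sup>2 \<le> 2 * (norm (g (?y (k + j))))\<^sup>2 + 2 * (K * (real n * h * norm (W x)))\<^sup>2"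
      by (rule order_trans)
    then show ?thesis by (simp add: c_def)
  qed
  have "real j * h * c \<le> (norm (?y k - xs))\<^sup>2 / 2 - (norm (?y (k + j) - xs))\<^sup>2 / 2" if "j \<le> n" for j
    using that
  proof (induction j)
    case (Suc j)
    have "h * c \<le> h * (norm (g (?y (k + Suc j))))\<^sup>2"
      using slow[OF Suc.prems] h by simp
    also have "\<dots> \<le> (norm (?y (k + j) - xs))\<^sup>2 / 2 - (norm (?y (k + Suc j) - xs))\<^sup>2 / 2"
      using step[of "?y (k + j)"] by simp
    finally show ?case using Suc by (simp add: algebra_simps)
  qed simp
  from this[of n] show ?thesis by (simp add: c_def)
qed

text \<open>The limit of the block estimate as the step tends to zero: the energy inequality on one grid
  interval, with the time integral of \<open>|g|\<^sup>2\<close> replaced by a lower bound for it.\<close>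

lemma dissipation_interval:
  fixes g :: "'x \<Rightarrow> 'u::real_normed_vector"
  assumes diss: "\<And>x. x \<in> D \<Longrightarrow> (norm (g x))\<^sup>2 \<le> W x \<bullet> (x - xs)"
    and lip: "\<And>x z. norm (g x - g z) \<le> K * norm (x - z)" and "0 \<le> K"
    and "0 < \<delta>" and "x \<in> D"
  shows "\<delta> * max 0 ((norm (g (S (real i * \<delta>) x)))\<^sup>2 / 2 - (K * (\<delta> * norm (W x)))\<^sup>2)
    \<le> (norm (S (real i * \<delta>) x - xs))\<^sup>2 / 2 - (norm (S (real (Suc i) * \<delta>) x - xs))\<^sup>2 / 2"
proof (rule tendsto_le[OF sequentially_bot])
  let ?y = "\<lambda>k n. (J (\<delta> / real n) ^^ k) x"
  have g_cont: "continuous_on UNIV g"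
  proof (rule continuous_on_subset[OF lipschitz_on_continuous_on])
    show "K-lipschitz_on UNIV g" using lip \<open>0 \<le> K\<close> by (auto simp: lipschitz_on_def dist_norm)
  qed simp
  note lim = exponential_formula_blocks[OF \<open>0 < \<delta>\<close> \<open>x \<in> D\<close>]
  have "(\<lambda>n. g (?y (i * n) n)) \<longlonglongrightarrow> g (S (real i * \<delta>) x)"
    using continuous_on_tendsto_compose[OF g_cont lim] by simp
  then show "(\<lambda>n. \<delta> * max 0 ((norm (g (?y (i * n) n)))\<^sup>2 / 2 - (K * (\<delta> * norm (W x)))\<^sup>2))
      \<longlonglongrightarrow> \<delta> * max 0 ((norm (g (S (real i * \<delta>) x)))\<^sup>2 / 2 - (K * (\<delta> * norm (W x)))\<^sup>2)"
    by (intro tendsto_intros) auto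
  show "(\<lambda>n. (norm (?y (i * n) n - xs))\<^sup>2 / 2 - (norm (?y (Suc i * n) n - xs))\<^sup>2 / 2)
      \<longlonglongrightarrow> (norm (S (real i * \<delta>) x - xs))\<^sup>2 / 2 - (norm (S (real (Suc i) * \<delta>) x - xs))\<^sup>2 / 2"
    by (intro tendsto_intros lim) auto
  show "eventually (\<lambda>n. \<delta> * max 0 ((norm (g (?y (i * n) n)))\<^sup>2 / 2 - (K * (\<delta> * norm (W x)))\<^sup>2)
      \<le> (norm (?y (i * n) n - xs))\<^sup>2 / 2 - (norm (?y (Suc i * n) n - xs))\<^sup>2 / 2) sequentially"
    using eventually_small_step[OF \<open>0 < \<delta>\<close>]
  proof eventually_elim
    case (elim n)
    then have "real n * (\<delta> / real n) = \<delta>" by (cases "n = 0") auto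
    then show ?case
      using dissipation_block[of g xs K "\<delta> / real n" x n "i * n", OF diss lip \<open>0 \<le> K\<close> _ _ \<open>x \<in> D\<close>] elim
      by (simp only: add.commute mult_Suc)
  qed
qed

text \<open>The argument of Barbalat's lemma on a grid. The energy decreases and is nonnegative, so its drops
  over consecutive intervals of length \<open>\<delta>\<close> tend to zero and \<open>g\<close> becomes small at the grid points.
  Lipschitz continuity in time, for initial values in \<open>D\<close>, controls \<open>g\<close> in between.\<close>

lemma dissipated_output_vanishes:
  fixes g :: "'x \<Rightarrow> 'u::real_normed_vector"
  assumes diss: "\<And>x. x \<in> D \<Longrightarrow> (norm (g x))\<^sup>2 \<le> W x \<bullet> (x - xs)"
    and lip: "\<And>x z. norm (g x - g z) \<le> K * norm (x - z)" and "0 \<le> K"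
    and "x \<in> D"
  shows "((\<lambda>t. g (S t x)) \<longlongrightarrow> 0) at_top"
proof (rule tendstoI)
  fix e :: real
  assume "0 < e"
  define L where "L = K * norm (W x)"
  have "0 \<le> L" using \<open>0 \<le> K\<close> by (simp add: L_def)
  \<comment> \<open>Along the trajectory \<open>g\<close> has the Lipschitz constant \<open>L\<close> in time, so that it varies by at
    most \<open>e / 4\<close> on an interval of length \<open>\<delta>\<close>. The summand \<open>1\<close> covers the case \<open>L = 0\<close>.\<close>
  define \<delta> where "\<delta> = e / (4 * (L + 1))"
  have "0 < \<delta>" using \<open>0 < e\<close> \<open>0 \<le> L\<close> by (simp add: \<delta>_def)
  have L\<delta>: "L * \<delta> \<le> e / 4"
    using \<open>0 < e\<close> \<open>0 \<le> L\<close> by (simp add: \<delta>_def field_simps)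
  define E where "E i = (norm (S (real i * \<delta>) x - xs))\<^sup>2 / 2" for i
  have drop: "\<delta> * max 0 ((norm (g (S (real i * \<delta>) x)))\<^sup>2 / 2 - (L * \<delta>)\<^sup>2) \<le> E i - E (Suc i)" for i
    using dissipation_interval[OF diss lip \<open>0 \<le> K\<close> \<open>0 < \<delta>\<close> \<open>x \<in> D\<close>, of i]
    by (simp add: E_def L_def ac_simps)
  have "decseq E"
  proof (rule decseq_SucI)
    fix i
    have "0 \<le> \<delta> * max 0 ((norm (g (S (real i * \<delta>) x)))\<^sup>2 / 2 - (L * \<delta>)\<^sup>2)"
      using \<open>0 < \<delta>\<close> by simp
    then show "E (Suc i) \<le> E i" using drop[of i] by linarith
  qed
  then obtain E_lim where E: "E \<longlonglongrightarrow> E_lim"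
    using decseq_convergent[of E 0] by (auto simp: E_def)
  have "(\<lambda>i. E i - E (Suc i)) \<longlonglongrightarrow> E_lim - E_lim"
    by (intro tendsto_intros E LIMSEQ_Suc)
  then have "eventually (\<lambda>i. E i - E (Suc i) < \<delta> * (e\<^sup>2 / 16)) sequentially"
    by (rule order_tendstoD(2)) (use \<open>0 < \<delta>\<close> \<open>0 < e\<close> in simp)
  then obtain N where N: "\<And>i. i \<ge> N \<Longrightarrow> E i - E (Suc i) < \<delta> * (e\<^sup>2 / 16)"
    by (auto simp: eventually_sequentially)
  have grid: "norm (g (S (real i * \<delta>) x)) < e / 2" if "i \<ge> N" for i
  proof -
    let ?f = "norm (g (S (real i * \<delta>) x))"
    have "\<delta> * (?f\<^sup>2 / 2 - (L * \<delta>)\<^sup>2) \<le> \<delta> * max 0 (?f\<^sup>2 / 2 - (L * \<delta>)\<^sup>2)"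
      using \<open>0 < \<delta>\<close> by (intro mult_left_mono) auto
    also have "\<dots> < \<delta> * (e\<^sup>2 / 16)" using drop[of i] N[OF that] by linarith
    finally have "?f\<^sup>2 / 2 - (L * \<delta>)\<^sup>2 < e\<^sup>2 / 16" using \<open>0 < \<delta>\<close> by simp
    moreover have "(L * \<delta>)\<^sup>2 \<le> (e / 4)\<^sup>2"
      using L\<delta> \<open>0 \<le> L\<close> \<open>0 < \<delta>\<close> by (intro power_mono) auto
    ultimately have "?f\<^sup>2 < (e / 2)\<^sup>2" by (simp add: power_divide field_simps)
    then show ?thesis using power_less_imp_less_base[of ?f 2 "e / 2"] \<open>0 < e\<close> by simp
  qed
  show "eventually (\<lambda>t. dist (g (S t x)) 0 < e) at_top"
    unfolding eventually_at_top_linorder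
  proof (intro exI[of _ "real (Suc N) * \<delta>"] allI impI)
    fix t
    assume t: "real (Suc N) * \<delta> \<le> t"
    define i where "i = nat \<lfloor>t / \<delta>\<rfloor>"
    have "real (Suc N) \<le> t / \<delta>" using t \<open>0 < \<delta>\<close> by (simp add: pos_le_divide_eq)
    then have "real i \<le> t / \<delta>" "t / \<delta> < real i + 1" "i \<ge> N"
      unfolding i_def by linarith+
    then have i: "real i * \<delta> \<le> t" "t < real i * \<delta> + \<delta>" "i \<ge> N"
      using \<open>0 < \<delta>\<close> by (simp_all add: field_simps)
    have "0 \<le> real i * \<delta>" using \<open>0 < \<delta>\<close> by simp
    have "norm (S t x - S (real i * \<delta>) x) \<le> norm (W x) * \<bar>t - real i * \<delta>\<bar>"
      using i(1) \<open>0 \<le> real i * \<delta>\<close> \<open>x \<in> D\<close>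
      by (intro semigroup_lipschitz) (auto intro: order_trans)
    also have "\<dots> \<le> norm (W x) * \<delta>" using i by (intro mult_left_mono) auto
    finally have "norm (g (S t x) - g (S (real i * \<delta>) x)) \<le> K * (norm (W x) * \<delta>)"
      using lip[of "S t x" "S (real i * \<delta>) x"] \<open>0 \<le> K\<close> mult_left_mono order_trans by blast
    then have "norm (g (S t x) - g (S (real i * \<delta>) x)) \<le> e / 4"
      using L\<delta> by (simp add: L_def mult.assoc)
    then show "dist (g (S t x)) 0 < e"
      using grid[OF i(3)] norm_triangle_ineq2[of "g (S t x)" "g (S (real i * \<delta>) x)"] \<open>0 < e\<close> by simp
  qed
qed

end

section \<open>Closed-loop convergence\<close>

text \<open>Solving \<open>x + h * (M x + C x) = y\<close> amounts to a fixed point of the map that sends \<open>z\<close> to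
  \<open>resolvent D M h (y - h * C z)\<close>, which is a contraction with constant \<open>h * K\<close>.\<close>

lemma lipschitz_perturbation_range:
  fixes D :: "'x::{real_inner,complete_space} set"
  assumes max: "maximal_monotone D M" and "D \<noteq> {}"
    and lip: "\<And>x z. norm (C x - C z) \<le> K * norm (x - z)"
    and h: "0 < h" "h * K < 1"
  shows "\<exists>x\<in>D. x + h *\<^sub>R (M x + C x) = y"
proof -
  \<comment> \<open>For \<open>M\<close> itself every step size is admissible; any bound above \<open>h\<close> would do.\<close>
  interpret M: resolvent_scheme D M "h + 1"
  proof
    show "0 < h + 1" using h by simp
    show "0 \<le> (M x - M z) \<bullet> (x - z)" if "x \<in> D" "z \<in> D" for x z
      using max that by (fastforce simp: maximal_monotone_def monotone_graph_def op_graph_def)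
    show "\<exists>x\<in>D. x + h' *\<^sub>R M x = y" if "0 < h'" for h' y
      using minty_surjectivity[OF max \<open>D \<noteq> {}\<close> that] .
  qed
  define T where "T z = M.J h (y - h *\<^sub>R C z)" for z
  have contraction: "dist (T z) (T w) \<le> max 0 (h * K) * dist z w" for z w
  proof -
    have "norm (T z - T w) \<le> norm ((y - h *\<^sub>R C z) - (y - h *\<^sub>R C w))"
      unfolding T_def using h by (intro M.resolvent_nonexpansive) auto
    also have "(y - h *\<^sub>R C z) - (y - h *\<^sub>R C w) = h *\<^sub>R (C w - C z)"
      by (simp add: algebra_simps)
    also have "norm (h *\<^sub>R (C w - C z)) \<le> h * (K * norm (w - z))"
      using lip[of w z] h by simp
    also have "\<dots> \<le> max 0 (h * K) * norm (w - z)"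
      unfolding mult.assoc[symmetric] by (intro mult_right_mono) auto
    finally show ?thesis by (simp add: dist_norm norm_minus_commute)
  qed
  obtain x where x: "T x = x"
    using banach_fix_type[of "max 0 (h * K)" T] contraction h by auto
  have "x \<in> D" "x + h *\<^sub>R M x = y - h *\<^sub>R C x"
    using M.resolvent_solves[of h "y - h *\<^sub>R C x"] h x by (simp_all add: T_def)
  then show ?thesis by (intro bexI[of _ x]) (simp_all add: algebra_simps)
qed

theorem theorem3p7:
  fixes D :: "'x::{real_inner, complete_space} set"
    and M :: "'x \<Rightarrow> 'x"
    and B :: "'u::{real_inner, complete_space} \<Rightarrow> 'x"
    and F :: "'u set"
    and xs :: 'x and us :: 'u
  assumes "maximal_monotone D M"
    and "bounded_linear B"
    and "closed F" and "convex F"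
    and "xs \<in> D" and "us \<in> interior F"
    and "- M xs + B us = 0"
    and "VOVS D (closed_loop M B F xs us) B xs"
  shows "\<forall>x0 \<in> closure D.
           ((\<lambda>t. generated_semigroup D (closed_loop M B F xs us) t x0) \<longlongrightarrow> xs) at_top"
proof -
  let ?W = "closed_loop M B F xs us"
  interpret B: bounded_linear B by fact
  interpret A: bounded_linear "adjoint B" by (rule bounded_linear_adjoint_hilbert) fact
  have "us \<in> F" using assms(6) interior_subset by blast
  have "D \<noteq> {}" using assms(5) by blast
  have F: "closed F" "convex F" "F \<noteq> {}" using assms(3,4) \<open>us \<in> F\<close> by auto
  \<comment> \<open>\<open>a\<close> is the unsaturated feedback, and \<open>g\<close> the deviation of the saturated control from \<open>us\<close>.\<close>
  define a where "a x = us - adjoint B (x - xs)" for x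
  define g where "g x = proj_onto F (a x) - us" for x
  obtain K\<^sub>B where K\<^sub>B: "0 < K\<^sub>B" "\<And>u. norm (B u) \<le> norm u * K\<^sub>B" using B.pos_bounded by blast
  obtain K\<^sub>A where K\<^sub>A: "0 < K\<^sub>A" "\<And>x. norm (adjoint B x) \<le> norm x * K\<^sub>A" using A.pos_bounded by blast
  have W_eq: "?W x = M x - B (proj_onto F (a x))" for x
    by (simp add: closed_loop_def a_def)
  have a_diff: "a x - a z = - adjoint B (x - z)" for x z
    by (simp add: a_def A.diff)
  have M_mono: "0 \<le> (M x - M z) \<bullet> (x - z)" if "x \<in> D" "z \<in> D" for x z
    using assms(1) that by (fastforce simp: maximal_monotone_def monotone_graph_def op_graph_def)
  \<comment> \<open>The feedback contributes \<open>B\<^sup>* (x - z) = - (a x - a z)\<close>, so firm nonexpansiveness of the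
    projection turns it into dissipation.\<close>
  have W_diss: "(norm (proj_onto F (a x) - proj_onto F (a z)))\<^sup>2 \<le> (?W x - ?W z) \<bullet> (x - z)"
    if "x \<in> D" "z \<in> D" for x z
  proof -
    let ?p = "proj_onto F (a x) - proj_onto F (a z)"
    have "(?W x - ?W z) \<bullet> (x - z) = (M x - M z) \<bullet> (x - z) - B ?p \<bullet> (x - z)"
      by (simp add: W_eq B.diff inner_diff_left)
    also have "B ?p \<bullet> (x - z) = - (?p \<bullet> (a x - a z))"
      by (simp add: a_diff adjoint_hilbert[OF assms(2)])
    finally show ?thesis
      using M_mono[OF that] proj_onto_firmly_nonexpansive[OF F, of "a x" "a z"] by simp
  qed
  have g_lip: "norm (g x - g z) \<le> K\<^sub>A * norm (x - z)" for x z
  proof -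
    have "norm (g x - g z) \<le> norm (a x - a z)"
      using proj_onto_nonexpansive[OF F, of "a x" "a z"] by (simp add: g_def)
    also have "\<dots> \<le> K\<^sub>A * norm (x - z)" using K\<^sub>A(2)[of "x - z"] by (simp add: a_diff mult.commute)
    finally show ?thesis .
  qed
  have "a xs = us" by (simp add: a_def A.zero)
  then have P_xs: "proj_onto F (a xs) = us" using proj_onto_self[OF \<open>us \<in> F\<close>] by simp
  have W_xs: "?W xs = 0" using assms(7) by (simp add: W_eq P_xs)
  interpret resolvent_scheme D ?W "inverse (K\<^sub>B * K\<^sub>A)"
  proof
    show "0 < inverse (K\<^sub>B * K\<^sub>A)" using K\<^sub>A K\<^sub>B by simp
    show "0 \<le> (?W x - ?W z) \<bullet> (x - z)" if "x \<in> D" "z \<in> D" for x z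
      using W_diss[OF that] zero_le_power2 order_trans by blast
    fix h y
    assume h: "0 < h" "h < inverse (K\<^sub>B * K\<^sub>A)"
    let ?C = "\<lambda>x. - B (proj_onto F (a x))"
    have "norm (?C x - ?C z) \<le> (K\<^sub>B * K\<^sub>A) * norm (x - z)" for x z
    proof -
      have "norm (?C x - ?C z) = norm (B (g x - g z))"
        by (simp add: g_def B.diff norm_minus_commute)
      also have "\<dots> \<le> norm (g x - g z) * K\<^sub>B" by (rule K\<^sub>B)
      also have "\<dots> \<le> (K\<^sub>A * norm (x - z)) * K\<^sub>B" using g_lip K\<^sub>B(1) by (intro mult_right_mono) auto
      finally show ?thesis by (simp add: ac_simps)
    qed
    moreover have "h * (K\<^sub>B * K\<^sub>A) < 1" using h K\<^sub>A K\<^sub>B by (simp add: field_simps)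
    ultimately have "\<exists>x\<in>D. x + h *\<^sub>R (M x + ?C x) = y"
      using h by (intro lipschitz_perturbation_range[OF assms(1) \<open>D \<noteq> {}\<close>])
    then show "\<exists>x\<in>D. x + h *\<^sub>R ?W x = y" by (simp add: W_eq)
  qed
  have conv_D: "((\<lambda>t. S t x) \<longlongrightarrow> xs) at_top" if "x \<in> D" for x
  proof -
    have g_lim: "((\<lambda>t. g (S t x)) \<longlongrightarrow> 0) at_top"
    proof (rule dissipated_output_vanishes[where K = K\<^sub>A and xs = xs])
      show "(norm (g z))\<^sup>2 \<le> ?W z \<bullet> (z - xs)" if "z \<in> D" for z
        using W_diss[OF that assms(5)] by (simp add: g_def P_xs W_xs)
    qed (use g_lip K\<^sub>A that in auto)
    obtain r where r: "0 < r" "ball us r \<subseteq> interior F"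
      using assms(6) open_contains_ball open_interior by blast
    have "eventually (\<lambda>t. norm (g (S t x)) < r) at_top"
      using order_tendstoD(2)[OF tendsto_norm_zero[OF g_lim] r(1)] .
    \<comment> \<open>The saturation is eventually inactive, and then \<open>- g\<close> is the output error itself.\<close>
    then have "eventually (\<lambda>t. - g (S t x) = adjoint B (S t x - xs)) at_top"
    proof eventually_elim
      case (elim t)
      have "proj_onto F (a (S t x)) \<in> ball us r" 
        using elim by (simp add: g_def dist_norm norm_minus_commute)
      then have "proj_onto F (a (S t x)) = a (S t x)"
        using r by (intro proj_onto_interior F) auto
      then show ?case by (simp add: g_def a_def)
    qed
    moreover have "((\<lambda>t. - g (S t x)) \<longlongrightarrow> 0) at_top" using tendsto_minus[OF g_lim] by simp
    ultimately have "((\<lambda>t. adjoint B (S t x - xs)) \<longlongrightarrow> 0) at_top"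
      by (rule Lim_transform_eventually[rotated])
    then show ?thesis
      using assms(8) that closure_subset unfolding VOVS_def by blast
  qed
  \<comment> \<open>Nonexpansiveness carries the convergence from \<open>D\<close> to its closure.\<close>
  show ?thesis
  proof (intro ballI tendstoI)
    fix x\<^sub>0 and e :: real
    assume "x\<^sub>0 \<in> closure D" "0 < e"
    then obtain z where z: "z \<in> D" "dist z x\<^sub>0 < e / 2"
      by (meson closure_approachable half_gt_zero)
    then have "z \<in> closure D" using closure_subset by blast
    have "eventually (\<lambda>t. dist (S t z) xs < e / 2) at_top"
      by (rule tendstoD[OF conv_D[OF z(1)]]) (use \<open>0 < e\<close> in simp)
    with eventually_ge_at_top[of 0] show "eventually (\<lambda>t. dist (S t x\<^sub>0) xs < e) at_top"
    proof eventually_elim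
      case (elim t)
      have "dist (S t x\<^sub>0) (S t z) < e / 2"
        using semigroup_nonexpansive[OF elim(1) \<open>x\<^sub>0 \<in> closure D\<close> \<open>z \<in> closure D\<close>] z(2)
        by (simp add: dist_norm norm_minus_commute)
      then show ?case using dist_triangle_half_r[of "S t z" "S t x\<^sub>0" e xs] elim(2)
        by (simp add: dist_commute)
    qed
  qed
qed

end
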